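(* Let $G$ be a topological group and let $(X, \tau)$ be an MHP $G$-flow. Then $(X, \tau, \mathcal{U}_{X})$ is an adequate topo-uniform space.
   Context: All topological groups and spaces are Hausdorff. A $G$-flow is a (non-empty) compact Hausdorff space with a continuous left action of $G$. $\mathcal{N}_G$ denotes the collection of symmetric open neighborhoods of $1_G$. For $U,V\in\mathcal{N}_G$, write $V\ll U$ if there is $W\in\mathcal{N}_G$ with $WVW\subseteq U$. A $G$-flow $X$ is maximally highly proximal (MHP) if whenever $A\subseteq X$ is non-empty open and $x\in\overline{A}$, then $x\in\mathrm{int}(\overline{UA})$ for each $U\in\mathcal{N}_G$. For an MHP $G$-flow $X$ and $U\in\mathcal{N}_G$, let $\widehat{U}\subseteq X^2$ be defined by: $(x,y)\in\widehat{U}$ iff for all open $A\ni x$ and all $U_0\in\mathcal{N}_G$ with $U\ll U_0$ we have $y\in\overline{U_0A}$. $\mathcal{U}_X$ is the filter of subsets of $X^2$ generated by $\{\widehat{U}:U\in\mathcal{N}_G\}$. Uniform notation: for $U,V\subseteq X\times X$, $UV=\{(x,y):\exists z\ (x,z)\in U,\ (z,y)\in V\}$. For members $U,V$ of a uniformity $\mathcal{U}$ on $X$, $V\ll U$ means $WVW\subseteq U$ for some $W\in\mathcal{U}$. For $A\subseteq X$ and $U\in\mathcal{U}$, $A[U]=\{y\in X:\exists x\in A\ (x,y)\in U\}$ and $A(U)=\bigcup_{V\ll U}A[V]$. A uniformity is Hausdorff if the intersection of its members is the diagonal. A topo-uniform space is a triple $(X,\tau,\mathcal{U})$ where $X$ is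 a set, $\tau$ a topology on $X$, and $\mathcal{U}$ a Hausdorff uniformity on $X$ such that (1) $\mathcal{U}$ has a basis of $(\tau\times\tau)$-closed entourages, and (2) every $(\tau\times\tau)$-open neighborhood of the diagonal in $X^2$ belongs to $\mathcal{U}$. A topo-uniform space with $(X,\tau)$ compact is adequate if for a base of $U\in\mathcal{U}$ and each $\tau$-open $A\subseteq X$, the set $A(U)$ is $\tau$-open. *)

theory Defs
  imports "HOL-Analysis.Analysis" "HOL-Algebra.Group_Action"
begin

section \<open>Topological groups and flows\<close>

locale topological_group = group G for G (structure) +
  fixes T :: "'a topology"
  assumes topspace_group: "topspace T = carrier G"
    and Hausdorff_group: "Hausdorff_space T"
    and continuous_mult: "continuous_map (prod_topology T T) T (\<lambda>(g, h). g \<otimes> h)"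
    and continuous_inv: "continuous_map T T (\<lambda>g. inv g)"

definition sym_nbhds :: "('g, 'm) monoid_scheme \<Rightarrow> 'g topology \<Rightarrow> 'g set set" where
  "sym_nbhds G T = {U. openin T U \<and> \<one>\<^bsub>G\<^esub> \<in> U \<and> set_inv\<^bsub>G\<^esub> U = U}"

definition nbhd_ll :: "('g, 'm) monoid_scheme \<Rightarrow> 'g topology \<Rightarrow> 'g set \<Rightarrow> 'g set \<Rightarrow> bool" where
  "nbhd_ll G T V U \<longleftrightarrow> (\<exists>W \<in> sym_nbhds G T. W <#>\<^bsub>G\<^esub> V <#>\<^bsub>G\<^esub> W \<subseteq> U)"

text \<open>A \<open>G\<close>-flow on the space \<open>X\<close>; the action of \<open>g\<close> is the bijection \<open>\<phi> g\<close> of \<open>topspace X\<close>.\<close>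

locale G_flow = topological_group G T + group_action G "topspace X" \<phi>
  for G (structure) and T and X :: "'x topology" and \<phi> +
  assumes flow_nonempty: "topspace X \<noteq> {}"
    and flow_compact: "compact_space X"
    and flow_Hausdorff: "Hausdorff_space X"
    and continuous_action: "continuous_map (prod_topology T X) X (\<lambda>(g, x). \<phi> g x)"

definition act_set :: "('g \<Rightarrow> 'x \<Rightarrow> 'x) \<Rightarrow> 'g set \<Rightarrow> 'x set \<Rightarrow> 'x set" where
  "act_set \<phi> U A = {\<phi> g x | g x. g \<in> U \<and> x \<in> A}"

locale MHP_flow = G_flow +
  assumes MHP: "\<lbrakk>openin X A; A \<noteq> {}; x \<in> X closure_of A; U \<in> sym_nbhds G T\<rbrakk>
    \<Longrightarrow> x \<in> X interior_of (X closure_of (act_set \<phi> U A))"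

definition hat :: "('g, 'm) monoid_scheme \<Rightarrow> 'g topology \<Rightarrow> 'x topology \<Rightarrow> ('g \<Rightarrow> 'x \<Rightarrow> 'x)
    \<Rightarrow> 'g set \<Rightarrow> ('x \<times> 'x) set" where
  "hat G T X \<phi> U = {(x, y). x \<in> topspace X \<and> y \<in> topspace X \<and>
     (\<forall>A U\<^sub>0. openin X A \<and> x \<in> A \<and> U\<^sub>0 \<in> sym_nbhds G T \<and> nbhd_ll G T U U\<^sub>0
        \<longrightarrow> y \<in> X closure_of (act_set \<phi> U\<^sub>0 A))}"

text \<open>The filter generated by the sets \<open>hat G T X \<phi> U\<close>: the coarsest filter
  (greatest in the library's order on filters) having all of them as members.\<close>

definition MHP_uniformity :: "('g, 'm) monoid_scheme \<Rightarrow> 'g topology \<Rightarrow> 'x topology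
    \<Rightarrow> ('g \<Rightarrow> 'x \<Rightarrow> 'x) \<Rightarrow> ('x \<times> 'x) filter" where
  "MHP_uniformity G T X \<phi> = (INF U \<in> sym_nbhds G T. principal (hat G T X \<phi> U))"

section \<open>Topo-uniform spaces\<close>

text \<open>A filter on \<open>S \<times> S\<close>, for a subset \<open>S\<close> of the type, is represented by a filter on the whole
  product type that contains \<open>S \<times> S\<close>; its members as a filter on \<open>S \<times> S\<close> are the \<open>entourages\<close>.
  The class \<open>uniform_space\<close> is not applicable, since it identifies the topology with the one
  induced by the uniformity.\<close>

definition entourages :: "'x set \<Rightarrow> ('x \<times> 'x) filter \<Rightarrow> ('x \<times> 'x) set set" where
  "entourages S \<U> = {E. E \<subseteq> S \<times> S \<and> (\<forall>\<^sub>F p in \<U>. p \<in> E)}"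

definition uniformity_of :: "'x set \<Rightarrow> ('x \<times> 'x) filter \<Rightarrow> bool" where
  "uniformity_of S \<U> \<longleftrightarrow> \<U> \<le> principal (S \<times> S) \<and>
     (\<forall>E \<in> entourages S \<U>.
        Id_on S \<subseteq> E \<and> E\<inverse> \<in> entourages S \<U> \<and> (\<exists>D \<in> entourages S \<U>. D O D \<subseteq> E))"

definition Hausdorff_uniformity :: "'x set \<Rightarrow> ('x \<times> 'x) filter \<Rightarrow> bool" where
  "Hausdorff_uniformity S \<U> \<longleftrightarrow> uniformity_of S \<U> \<and> \<Inter> (entourages S \<U>) = Id_on S"

definition entourage_ll :: "'x set \<Rightarrow> ('x \<times> 'x) filter \<Rightarrow> ('x \<times> 'x) set \<Rightarrow> ('x \<times> 'x) set \<Rightarrow> bool" where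
  "entourage_ll S \<U> V U \<longleftrightarrow> (\<exists>W \<in> entourages S \<U>. W O V O W \<subseteq> U)"

text \<open>The set \<open>A(U)\<close>; the set \<open>A[V]\<close> is the library's relational image \<open>V `` A\<close>.\<close>

definition uopen_image :: "'x set \<Rightarrow> ('x \<times> 'x) filter \<Rightarrow> 'x set \<Rightarrow> ('x \<times> 'x) set \<Rightarrow> 'x set" where
  "uopen_image S \<U> A U = (\<Union>V \<in> {V \<in> entourages S \<U>. entourage_ll S \<U> V U}. V `` A)"

definition entourage_base :: "'x set \<Rightarrow> ('x \<times> 'x) filter \<Rightarrow> ('x \<times> 'x) set set \<Rightarrow> bool" where
  "entourage_base S \<U> \<B> \<longleftrightarrow>
     \<B> \<subseteq> entourages S \<U> \<and> (\<forall>E \<in> entourages S \<U>. \<exists>B \<in> \<B>. B \<subseteq> E)"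

locale topo_uniform_space =
  fixes X :: "'x topology" and \<U> :: "('x \<times> 'x) filter"
  assumes Hausdorff_top: "Hausdorff_space X"
    and Hausdorff_unif: "Hausdorff_uniformity (topspace X) \<U>"
    and closed_base: "\<exists>\<B>. entourage_base (topspace X) \<U> \<B> \<and> (\<forall>E \<in> \<B>. closedin (prod_topology X X) E)"
    and open_entourage: "\<lbrakk>openin (prod_topology X X) E; Id_on (topspace X) \<subseteq> E\<rbrakk>
      \<Longrightarrow> E \<in> entourages (topspace X) \<U>"

locale adequate_topo_uniform_space = topo_uniform_space +
  assumes compact_top: "compact_space X"
    and adequate: "\<exists>\<B>. entourage_base (topspace X) \<U> \<B> \<and>
      (\<forall>U \<in> \<B>. \<forall>A. openin X A \<longrightarrow> openin X (uopen_image (topspace X) \<U> A U))"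

end

theory Submission
  imports Defs
begin

text \<open>
  Read \<open>(x, y) \<in> hat U\<close> as ``\<open>y\<close> lies in the closure of \<open>U\<^sub>0 A\<close> for arbitrarily small
  neighbourhoods \<open>A\<close> of \<open>x\<close> and all \<open>U\<^sub>0\<close> slightly larger than \<open>U\<close>''. The sets
  \<open>hat U\<close> are closed, contain the diagonal, increase with \<open>U\<close>, and are symmetric because two open sets \<open>A\<close> and \<open>B\<close> with \<open>U\<^sub>0 B\<close> disjoint
  from \<open>A\<close> also have \<open>U\<^sub>0 A\<close> disjoint from \<open>B\<close>, when \<open>U\<^sub>0\<close> is symmetric. Joint continuity of
  the action at the identity shows that they intersect in the diagonal. Being closed and directed,
  they are eventually contained in any open neighbourhood of the diagonal, by compactness.

  Maximal high proximality enters when relations are composed. If \<open>y\<close> is in the closure of an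
  open set \<open>P\<close>, then it is in the interior of the closure of \<open>S P\<close> for any small \<open>S\<close>; so the
  relation \<open>(y, z) \<in> hat V\<close> can be tested on that interior, and puts \<open>z\<close> in the closure of
  \<open>V\<^sub>0 S P\<close> whenever \<open>V \<lless> V\<^sub>0\<close> (\<open>hat_closure_step\<close>). Three such steps
  give \<open>hat D O hat V O hat D \<subseteq> hat U\<close> for a small \<open>D\<close> whenever \<open>V \<lless> U\<close> (\<open>hat_sandwich\<close>),
  and this one inclusion yields both the uniformity axiom and the relation \<open>\<lless>\<close> between
  entourages.

  For adequacy the base must be chosen with care: the sets \<open>E = (\<Union>V \<lless> U. hat V)\<close> are used. Since
  \<open>\<lless>\<close> interpolates, every \<open>hat V\<close> with \<open>V \<lless> U\<close> satisfies \<open>hat V \<lless> E\<close>, so \<open>A(E)\<close> is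
  simply \<open>A[E]\<close>. To see that \<open>A[E]\<close> is open, let \<open>(x, y) \<in> hat V\<close> with \<open>x \<in> A\<close>, and choose a
  neighbourhood \<open>B\<close> of \<open>x\<close> inside a closed set \<open>K \<subseteq> A\<close>. For \<open>V \<lless> V\<^sub>1 \<lless> V\<^sub>2 \<lless> U\<close> the point
  \<open>y\<close> is in the closure of \<open>V\<^sub>1 B\<close>, hence in the interior of the closure of \<open>V\<^sub>2 B\<close>. By
  compactness that closure is contained in \<open>K[hat V\<^sub>2]\<close>, and so in \<open>A[E]\<close>.
\<close>

\<comment> \<open>This prefix notation for closure under an equivalence makes every topological
  \<open>closure_of\<close> ambiguous.\<close>
no_notation eq_closure_of ("closure'_of\<index>")

section \<open>Symmetric neighbourhoods of the identity\<close>

context topological_group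
begin

lemma sym_nbhdsD:
  assumes "U \<in> sym_nbhds G T"
  shows "openin T U" "\<one> \<in> U" "U \<subseteq> carrier G" "\<And>g. g \<in> U \<Longrightarrow> inv g \<in> U"
  using assms openin_subset[of T U] topspace_group
  by (auto simp: sym_nbhds_def SET_INV_def)

lemma sym_nbhdsI:
  assumes "openin T U" "\<one> \<in> U" "\<And>g. g \<in> U \<Longrightarrow> inv g \<in> U"
  shows "U \<in> sym_nbhds G T"
proof -
  have sub: "U \<subseteq> carrier G"
    using assms(1) openin_subset topspace_group by blast
  have "g \<in> set_inv U" if "g \<in> U" for g
    using that assms(3)[OF that] sub inv_inv[of g] unfolding SET_INV_def by force
  then show ?thesis
    using assms by (auto simp: sym_nbhds_def SET_INV_def)
qed

lemma set_multI: "g \<in> U \<Longrightarrow> h \<in> V \<Longrightarrow> g \<otimes> h \<in> U <#> V"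
  unfolding set_mult_def by blast

lemma sym_nbhds_Int:
  "U \<in> sym_nbhds G T \<Longrightarrow> V \<in> sym_nbhds G T \<Longrightarrow> U \<inter> V \<in> sym_nbhds G T"
  by (rule sym_nbhdsI) (auto dest: sym_nbhdsD)

lemma carrier_sym_nbhd: "carrier G \<in> sym_nbhds G T"
  using openin_topspace[of T] by (intro sym_nbhdsI) (auto simp: topspace_group)

lemma sym_nbhd_inside_open:
  assumes "openin T Q" "\<one> \<in> Q"
  shows "\<exists>W \<in> sym_nbhds G T. W \<subseteq> Q"
proof
  let ?W = "Q \<inter> {g \<in> topspace T. inv g \<in> Q}"
  have "openin T {g \<in> topspace T. inv g \<in> Q}"
    using openin_continuous_map_preimage[OF continuous_inv assms(1)] .
  then show "?W \<in> sym_nbhds G T"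
    using assms topspace_group by (intro sym_nbhdsI) auto
qed auto

lemma sym_nbhd_square_inside:
  assumes "U \<in> sym_nbhds G T"
  shows "\<exists>W \<in> sym_nbhds G T. W <#> W \<subseteq> U"
proof -
  let ?P = "{p \<in> topspace (prod_topology T T). (case p of (g, h) \<Rightarrow> g \<otimes> h) \<in> U}"
  have "openin (prod_topology T T) ?P"
    using openin_continuous_map_preimage[OF continuous_mult sym_nbhdsD(1)[OF assms]] .
  moreover have "(\<one>, \<one>) \<in> ?P"
    using sym_nbhdsD(2)[OF assms] topspace_group by auto
  ultimately obtain A B where AB: "openin T A" "openin T B" "\<one> \<in> A" "\<one> \<in> B" "A \<times> B \<subseteq> ?P"
    unfolding openin_prod_topology_alt by meson
  then obtain W where "W \<in> sym_nbhds G T" "W \<subseteq> A \<inter> B"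
    using sym_nbhd_inside_open[of "A \<inter> B"] by blast
  then show ?thesis
    using AB(5) by (intro bexI[of _ W]) (fastforce simp: set_mult_def)+
qed

lemma subset_set_mult_left: "U \<in> sym_nbhds G T \<Longrightarrow> V \<subseteq> carrier G \<Longrightarrow> V \<subseteq> U <#> V"
  using sym_nbhdsD(2) set_multI[of \<one> U] l_one by (metis subset_iff)

lemma subset_set_mult_right: "U \<in> sym_nbhds G T \<Longrightarrow> V \<subseteq> carrier G \<Longrightarrow> V \<subseteq> V <#> U"
  using sym_nbhdsD(2) set_multI[of _ V \<one> U] r_one by (metis subset_iff)

lemma openin_set_mult:
  assumes "W \<subseteq> carrier G" "openin T V"
  shows "openin T (W <#> V)"
proof -
  have V: "V \<subseteq> carrier G"
    using assms(2) openin_subset topspace_group by blast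
  have *: "W <#> V = (\<Union>w \<in> W. {g \<in> topspace T. inv w \<otimes> g \<in> V})" (is "_ = ?R")
  proof
    show "W <#> V \<subseteq> ?R"
    proof
      fix g assume "g \<in> W <#> V"
      then obtain w v where w: "w \<in> W" "v \<in> V" "g = w \<otimes> v"
        unfolding set_mult_def by blast
      then have "w \<in> carrier G" "v \<in> carrier G"
        using assms(1) V by auto
      then have "g \<in> {g \<in> topspace T. inv w \<otimes> g \<in> V}"
        using w by (simp add: topspace_group m_assoc[symmetric])
      then show "g \<in> ?R" using w(1) by blast
    qed
    show "?R \<subseteq> W <#> V"
    proof
      fix g assume "g \<in> ?R"
      then obtain w where w: "w \<in> W" "g \<in> carrier G" "inv w \<otimes> g \<in> V"
        using topspace_group by auto
      then have "w \<otimes> (inv w \<otimes> g) = g"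
        using assms(1) by (simp add: m_assoc[symmetric] subset_iff)
      then show "g \<in> W <#> V"
        using set_multI[OF w(1,3)] by simp
    qed
  qed
  have "continuous_map T T (\<lambda>g. inv w \<otimes> g)" if "w \<in> W" for w
  proof -
    have "continuous_map T (prod_topology T T) (\<lambda>g. (inv w, g))"
      using that assms(1) topspace_group by (auto intro!: continuous_map_pairedI)
    then show ?thesis
      using continuous_map_compose[OF _ continuous_mult, of T "Pair (inv w)"]
      by (simp add: o_def)
  qed
  then show ?thesis
    unfolding * by (auto intro: openin_continuous_map_preimage assms(2))
qed

text \<open>Supplies the intermediate neighbourhoods that interpolate the relation \<open>\<lless>\<close>.\<close>

lemma sym_nbhd_sandwich:
  assumes W: "W \<in> sym_nbhds G T" and V: "V \<in> sym_nbhds G T"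
  shows "W <#> V <#> W \<in> sym_nbhds G T"
proof (rule sym_nbhdsI)
  have *: "W \<subseteq> carrier G" "V \<subseteq> carrier G"
    using sym_nbhdsD W V by auto
  show "openin T (W <#> V <#> W)"
    using openin_set_mult[of "W <#> V" W] set_mult_closed[of W V] * W sym_nbhdsD(1) by blast
  show "\<one> \<in> W <#> V <#> W"
    using set_multI[OF set_multI[OF sym_nbhdsD(2)[OF W] sym_nbhdsD(2)[OF V]] sym_nbhdsD(2)[OF W]]
    by simp
  fix g assume "g \<in> W <#> V <#> W"
  then obtain a v b where g: "a \<in> W" "v \<in> V" "b \<in> W" "g = a \<otimes> v \<otimes> b"
    by (auto simp: set_mult_def)
  then have c: "a \<in> carrier G" "v \<in> carrier G" "b \<in> carrier G"
    using * by auto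
  then have "inv g = inv b \<otimes> inv v \<otimes> inv a"
    using g by (simp add: inv_mult_group m_assoc)
  then show "inv g \<in> W <#> V <#> W"
    using g sym_nbhdsD(4)[OF W] sym_nbhdsD(4)[OF V] set_multI by metis
qed

lemma nbhd_ll_imp_subset:
  assumes "nbhd_ll G T V U" "V \<subseteq> carrier G"
  shows "V \<subseteq> U"
proof -
  obtain W where W: "W \<in> sym_nbhds G T" "W <#> V <#> W \<subseteq> U"
    using assms(1) unfolding nbhd_ll_def by auto
  have "V \<subseteq> W <#> V"
    using W assms(2) subset_set_mult_left by auto
  also have "\<dots> \<subseteq> W <#> V <#> W"
    using W assms(2) sym_nbhdsD(3) set_mult_closed by (intro subset_set_mult_right) auto
  finally show ?thesis using W by auto
qed

lemma nbhd_ll_mono_left: "nbhd_ll G T V U \<Longrightarrow> V' \<subseteq> V \<Longrightarrow> nbhd_ll G T V' U"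
  unfolding nbhd_ll_def using mono_set_mult by (meson order.trans order_refl)

lemma nbhd_ll_below:
  assumes "U \<in> sym_nbhds G T"
  shows "\<exists>V \<in> sym_nbhds G T. nbhd_ll G T V U"
proof -
  obtain H where H: "H \<in> sym_nbhds G T" "H <#> H \<subseteq> U"
    using sym_nbhd_square_inside assms by blast
  obtain W where W: "W \<in> sym_nbhds G T" "W <#> W \<subseteq> H"
    using sym_nbhd_square_inside H by blast
  have "W \<subseteq> H"
    using subset_set_mult_left[OF W(1) sym_nbhdsD(3)[OF W(1)]] W(2) by blast
  then have "W <#> W <#> W \<subseteq> U"
    using mono_set_mult[OF W(2), of W H] H by blast
  then show ?thesis
    using W unfolding nbhd_ll_def by blast
qed

text \<open>If \<open>S S \<subseteq> W\<close>, half of the room \<open>W\<close> can be spent on each side of \<open>S V S\<close>.\<close>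

lemma nbhd_ll_interpolate:
  assumes V: "V \<in> sym_nbhds G T" and "nbhd_ll G T V U"
  shows "\<exists>V' \<in> sym_nbhds G T. nbhd_ll G T V V' \<and> nbhd_ll G T V' U"
proof -
  obtain W where W: "W \<in> sym_nbhds G T" "W <#> V <#> W \<subseteq> U"
    using assms(2) unfolding nbhd_ll_def by auto
  obtain S where S: "S \<in> sym_nbhds G T" "S <#> S \<subseteq> W"
    using sym_nbhd_square_inside W by blast
  have c: "S \<subseteq> carrier G" "V \<subseteq> carrier G"
    using S V sym_nbhdsD by auto
  have "S <#> (S <#> V <#> S) <#> S = (S <#> S) <#> V <#> (S <#> S)"
    using c by (simp add: set_mult_assoc set_mult_closed)
  also have "\<dots> \<subseteq> W <#> V <#> W"
    using S by (intro mono_set_mult) auto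
  finally have "nbhd_ll G T (S <#> V <#> S) U"
    using W S unfolding nbhd_ll_def by blast
  moreover have "nbhd_ll G T V (S <#> V <#> S)"
    using S unfolding nbhd_ll_def by blast
  ultimately show ?thesis
    using sym_nbhd_sandwich[OF S(1) V] by blast
qed

end

section \<open>Thickening subsets of a flow\<close>

lemma act_set_mono: "U \<subseteq> V \<Longrightarrow> A \<subseteq> B \<Longrightarrow> act_set \<phi> U A \<subseteq> act_set \<phi> V B"
  unfolding act_set_def by blast

context G_flow
begin

lemma act_set_act_set:
  assumes "U \<subseteq> carrier G" "V \<subseteq> carrier G" "A \<subseteq> topspace X"
  shows "act_set \<phi> U (act_set \<phi> V A) = act_set \<phi> (U <#> V) A"
proof -
  have "\<phi> (g \<otimes> h) a = \<phi> g (\<phi> h a)" if "g \<in> U" "h \<in> V" "a \<in> A" for g h a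
    using composition_rule that assms by blast
  then show ?thesis
    unfolding act_set_def set_mult_def by (auto; metis)
qed

lemma act_one: "x \<in> topspace X \<Longrightarrow> \<phi> \<one> x = x"
  by (simp flip: id_eq_one)

lemma act_set_subset_topspace:
  assumes "U \<subseteq> carrier G" "A \<subseteq> topspace X"
  shows "act_set \<phi> U A \<subseteq> topspace X"
  using assms element_image unfolding act_set_def by blast

lemma continuous_map_act:
  assumes "g \<in> carrier G"
  shows "continuous_map X X (\<phi> g)"
proof -
  have "continuous_map X (prod_topology T X) (\<lambda>x. (g, x))"
    using assms topspace_group by (auto intro!: continuous_map_pairedI)
  then show ?thesis
    using continuous_map_compose[OF _ continuous_action, of X "Pair g"]
    by (simp add: o_def)
qed

lemma act_inv_cancel:
  assumes "g \<in> carrier G" "x \<in> topspace X"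
  shows "\<phi> (inv g) (\<phi> g x) = x"
  using assms orbit_sym_aux by blast

lemma openin_act_set:
  assumes "U \<subseteq> carrier G" "openin X A"
  shows "openin X (act_set \<phi> U A)"
proof -
  have "act_set \<phi> U A = (\<Union>g \<in> U. {x \<in> topspace X. \<phi> (inv g) x \<in> A})" (is "_ = ?R")
  proof
    show "act_set \<phi> U A \<subseteq> ?R"
    proof
      fix y assume "y \<in> act_set \<phi> U A"
      then obtain g x where g: "g \<in> U" "x \<in> A" "y = \<phi> g x"
        unfolding act_set_def by blast
      have "x \<in> topspace X" using g openin_subset[OF assms(2)] by blast
      then show "y \<in> ?R"
        using g assms(1) act_inv_cancel[of g x] element_image[of g x y] by (intro UN_I[of g]) auto
    qed
    show "?R \<subseteq> act_set \<phi> U A"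
    proof
      fix y assume "y \<in> ?R"
      then obtain g where g: "g \<in> U" "y \<in> topspace X" "\<phi> (inv g) y \<in> A" by blast
      then have "\<phi> g (\<phi> (inv g) y) = y"
        using assms(1) act_inv_cancel[of "inv g" y] by auto
      then show "y \<in> act_set \<phi> U A"
        using g unfolding act_set_def by force
    qed
  qed
  moreover have "openin X {x \<in> topspace X. \<phi> (inv g) x \<in> A}" if "g \<in> U" for g
    using openin_continuous_map_preimage[OF continuous_map_act assms(2), of "inv g"]
      that assms(1) by auto
  ultimately show ?thesis by auto
qed

lemma act_set_closure_of_subset:
  assumes "U \<subseteq> carrier G"
  shows "act_set \<phi> U (X closure_of A) \<subseteq> X closure_of (act_set \<phi> U A)"
proof
  fix y assume "y \<in> act_set \<phi> U (X closure_of A)"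
  then obtain g x where g: "g \<in> U" "x \<in> X closure_of A" "y = \<phi> g x"
    unfolding act_set_def by blast
  have "\<phi> g ` (X closure_of A) \<subseteq> X closure_of (\<phi> g ` A)"
    using continuous_map_act g assms continuous_map_image_closure_subset by blast
  also have "\<dots> \<subseteq> X closure_of (act_set \<phi> U A)"
    using g by (intro closure_of_mono) (auto simp: act_set_def)
  finally show "y \<in> X closure_of (act_set \<phi> U A)"
    using g by blast
qed

text \<open>Separate \<open>y\<close> from a closed neighbourhood of \<open>x\<close>, and use continuity of the action at
  \<open>(\<one>, x)\<close> to keep \<open>U A\<close> inside it. This is what makes the uniformity Hausdorff.\<close>

lemma act_set_avoids_point:
  assumes "x \<in> topspace X" "y \<in> topspace X" "x \<noteq> y"
  shows "\<exists>U \<in> sym_nbhds G T. \<exists>A. openin X A \<and> x \<in> A \<and> y \<notin> X closure_of (act_set \<phi> U A)"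
proof -
  have nb: "neighbourhood_base_of (closedin X) X"
    using flow_compact flow_Hausdorff neighbourhood_base_of_closedin
      compact_Hausdorff_imp_regular_space by blast
  have "openin X (topspace X - {y})"
    using closedin_Hausdorff_singleton[OF flow_Hausdorff assms(2)] by blast
  then obtain C D where CD: "openin X C" "closedin X D" "x \<in> C" "C \<subseteq> D" "D \<subseteq> topspace X - {y}"
    using nb assms unfolding neighbourhood_base_of by (metis DiffI singletonD)
  let ?P = "{p \<in> topspace (prod_topology T X). (case p of (g, z) \<Rightarrow> \<phi> g z) \<in> C}"
  have "openin (prod_topology T X) ?P"
    using openin_continuous_map_preimage[OF continuous_action CD(1)] .
  moreover have "(\<one>, x) \<in> ?P"
    using CD assms topspace_group act_one by auto
  ultimately obtain A B where AB: "openin T A" "openin X B" "\<one> \<in> A" "x \<in> B" "A \<times> B \<subseteq> ?P"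
    unfolding openin_prod_topology_alt by meson
  then obtain U where U: "U \<in> sym_nbhds G T" "U \<subseteq> A"
    using sym_nbhd_inside_open by blast
  then have "act_set \<phi> U B \<subseteq> D"
    using AB(5) CD(4) unfolding act_set_def by fastforce
  then have "y \<notin> X closure_of (act_set \<phi> U B)"
    using closure_of_minimal CD by blast
  then show ?thesis using U AB by blast
qed

section \<open>The relations \<open>hat\<close>\<close>

abbreviation N where "N \<equiv> sym_nbhds G T"
abbreviation H where "H \<equiv> hat G T X \<phi>"

lemma hatD:
  assumes "(x, y) \<in> H U" "openin X A" "x \<in> A" "U' \<in> N" "nbhd_ll G T U U'"
  shows "y \<in> X closure_of (act_set \<phi> U' A)"
  using assms by (simp add: hat_def)

lemma hat_subset: "H U \<subseteq> topspace X \<times> topspace X"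
  unfolding hat_def by auto

lemma hat_mono: "U \<subseteq> V \<Longrightarrow> H U \<subseteq> H V"
  unfolding hat_def by (auto dest: nbhd_ll_mono_left)

lemma act_in_hat:
  assumes "U \<in> N" "g \<in> U" "x \<in> topspace X"
  shows "(x, \<phi> g x) \<in> H U"
proof -
  have U: "U \<subseteq> carrier G" using sym_nbhdsD(3)[OF assms(1)] .
  have gx: "\<phi> g x \<in> topspace X"
    using U assms element_image by blast
  have "\<phi> g x \<in> X closure_of (act_set \<phi> U' A)"
    if "openin X A" "x \<in> A" "U' \<in> N" "nbhd_ll G T U U'" for A U'
  proof -
    have "\<phi> g x \<in> act_set \<phi> U' A"
      using nbhd_ll_imp_subset[OF that(4) U] assms(2) that(2) unfolding act_set_def by blast
    then show ?thesis using gx closure_of_subset_Int by fastforce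
  qed
  then show ?thesis using gx assms(3) unfolding hat_def by blast
qed

lemma Id_on_subset_hat: "U \<in> N \<Longrightarrow> Id_on (topspace X) \<subseteq> H U"
  using act_in_hat[OF _ sym_nbhdsD(2)] act_one by fastforce

text \<open>If \<open>x\<close> were outside the closure of \<open>U' B\<close>, the complement \<open>A\<close> of that closure would be a
  neighbourhood of \<open>x\<close> disjoint from \<open>U' B\<close>; as \<open>U'\<close> is symmetric, \<open>U' A\<close> would miss the
  neighbourhood \<open>B\<close> of \<open>y\<close>.\<close>

lemma hat_sym:
  assumes "(x, y) \<in> H U"
  shows "(y, x) \<in> H U"
proof -
  have xy: "x \<in> topspace X" "y \<in> topspace X"
    using assms hat_subset by auto
  have "x \<in> X closure_of (act_set \<phi> U' B)"
    if B: "openin X B" "y \<in> B" and U': "U' \<in> N" "nbhd_ll G T U U'" for B U'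
  proof (rule ccontr)
    let ?A = "topspace X - X closure_of (act_set \<phi> U' B)"
    assume "x \<notin> X closure_of (act_set \<phi> U' B)"
    then have "y \<in> X closure_of (act_set \<phi> U' ?A)"
      using assms U' xy by (intro hatD[OF assms]) auto
    then obtain z where "z \<in> B" "z \<in> act_set \<phi> U' ?A"
      using B unfolding in_closure_of by blast
    then obtain g a where g: "g \<in> U'" "a \<in> ?A" "\<phi> g a \<in> B"
      unfolding act_set_def by blast
    have gc: "g \<in> carrier G" using sym_nbhdsD(3)[OF U'(1)] g by blast
    have "a = \<phi> (inv g) (\<phi> g a)"
      using act_inv_cancel gc g by simp
    then have "a \<in> act_set \<phi> U' B"
      using g sym_nbhdsD(4)[OF U'(1)] unfolding act_set_def by blast
    then show False
      using g closure_of_subset[OF act_set_subset_topspace[OF sym_nbhdsD(3)[OF U'(1)] openin_subset[OF B(1)]]]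
      by blast
  qed
  then show ?thesis using xy unfolding hat_def by blast
qed

text \<open>A pair is excluded from \<open>hat U\<close> by an open set \<open>A\<close> and some \<open>U'\<close>, and the same witnesses
  exclude every pair in \<open>A\<close> times the complement of the closure of \<open>U' A\<close>.\<close>

lemma closedin_hat: "closedin (prod_topology X X) (H U)"
proof -
  have "\<exists>A B. openin X A \<and> openin X B \<and> x \<in> A \<and> y \<in> B
      \<and> A \<times> B \<subseteq> topspace X \<times> topspace X - H U"
    if "x \<in> topspace X" "y \<in> topspace X" and n: "(x, y) \<notin> H U" for x y
  proof -
    have "\<exists>A U'. openin X A \<and> x \<in> A \<and> U' \<in> N \<and> nbhd_ll G T U U'
        \<and> y \<notin> X closure_of (act_set \<phi> U' A)"
      using that by (simp add: hat_def)
    then obtain A U' where A: "openin X A" "x \<in> A" "U' \<in> N" "nbhd_ll G T U U'"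
      "y \<notin> X closure_of (act_set \<phi> U' A)"
      by (elim exE conjE)
    let ?B = "topspace X - X closure_of (act_set \<phi> U' A)"
    have "A \<times> ?B \<inter> H U = {}"
      using hatD[OF _ A(1) _ A(3,4)] by blast
    moreover have "A \<times> ?B \<subseteq> topspace X \<times> topspace X"
      using openin_subset[OF A(1)] by blast
    ultimately have "A \<times> ?B \<subseteq> topspace X \<times> topspace X - H U" by blast
    moreover have "openin X ?B" by (simp add: openin_diff)
    ultimately show ?thesis
      using A(1,2,5) that(2) by (intro exI[of _ A] exI[of _ ?B]) simp
  qed
  then have "openin (prod_topology X X) (topspace X \<times> topspace X - H U)"
    unfolding openin_prod_topology_alt by simp
  then show ?thesis
    using hat_subset by (simp add: closedin_def)
qed

lemma Inter_hat: "(\<Inter>U \<in> N. H U) = Id_on (topspace X)"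
proof
  show "Id_on (topspace X) \<subseteq> (\<Inter>U \<in> N. H U)"
    using Id_on_subset_hat by blast
  show "(\<Inter>U \<in> N. H U) \<subseteq> Id_on (topspace X)"
  proof clarify
    fix x y assume xy: "(x, y) \<in> (\<Inter>U \<in> N. H U)"
    then have t: "x \<in> topspace X" "y \<in> topspace X"
      using hat_subset carrier_sym_nbhd by auto
    have "x = y"
    proof (rule ccontr)
      assume "x \<noteq> y"
      then obtain U A where U: "U \<in> N" "openin X A" "x \<in> A" "y \<notin> X closure_of (act_set \<phi> U A)"
        using act_set_avoids_point t by blast
      obtain V where "V \<in> N" "nbhd_ll G T V U"
        using nbhd_ll_below U by blast
      then show False using xy U hatD by blast
    qed
    then show "(x, y) \<in> Id_on (topspace X)" using t by auto
  qed
qed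

text \<open>The family \<open>hat\<close> is directed downwards, as compactness arguments require.\<close>

lemma hat_finite_lower_bound:
  assumes "finite F" "F \<subseteq> N"
  shows "\<exists>V \<in> N. \<forall>U \<in> F. H V \<subseteq> H U"
proof -
  \<comment> \<open>Intersecting with the whole space covers the empty family.\<close>
  have "topspace T \<inter> \<Inter>F \<in> N"
    using assms
  proof (induction F)
    case empty
    then show ?case using carrier_sym_nbhd topspace_group by simp
  next
    case (insert U F)
    then show ?case
      using sym_nbhds_Int[of U "topspace T \<inter> \<Inter>F"] by (simp add: Int_left_commute)
  qed
  then show ?thesis
    using hat_mono by (metis Inter_lower le_infI2)
qed

text \<open>The complement of \<open>E\<close> is compact and is covered by the open complements of the sets \<open>hat U\<close>,
  which by directedness form an increasing family.\<close>

lemma hat_subset_open: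
  assumes "openin (prod_topology X X) E" "Id_on (topspace X) \<subseteq> E"
  shows "\<exists>U \<in> N. H U \<subseteq> E"
proof -
  let ?P = "prod_topology X X"
  let ?\<C> = "(\<lambda>U. topspace ?P - H U) ` N"
  have "compactin ?P (topspace ?P - E)"
    using assms(1) flow_compact
    by (intro closedin_compact_space closedin_diff closedin_topspace)
      (auto simp: compact_space_prod_topology)
  moreover have "\<forall>C \<in> ?\<C>. openin ?P C"
    using closedin_hat by blast
  moreover have "topspace ?P - E \<subseteq> \<Union> ?\<C>"
  proof -
    have "topspace ?P - E \<subseteq> topspace ?P - (\<Inter>U \<in> N. H U)"
      using assms(2) unfolding Inter_hat by (rule Diff_mono[OF order_refl])
    then show ?thesis by simp
  qed
  ultimately obtain \<F> where \<F>: "finite \<F>" "\<F> \<subseteq> ?\<C>" "topspace ?P - E \<subseteq> \<Union> \<F>"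
    unfolding compactin_def by meson
  obtain F where F: "finite F" "F \<subseteq> N" "\<F> = (\<lambda>U. topspace ?P - H U) ` F"
    using finite_subset_image[OF \<F>(1,2)] by auto
  obtain V where V: "V \<in> N" "\<forall>U \<in> F. H V \<subseteq> H U"
    using hat_finite_lower_bound F by blast
  have "H V \<subseteq> E"
  proof (rule ccontr)
    assume "\<not> H V \<subseteq> E"
    then obtain p where p: "p \<in> H V" "p \<notin> E" by blast
    then have "p \<in> topspace ?P - E"
      using hat_subset by (metis DiffI subsetD topspace_prod_topology)
    then show False
      using \<F>(3) F(3) V(2) p(1) by blast
  qed
  then show ?thesis using V by blast
qed

text \<open>The image \<open>K[hat U]\<close> is the projection of a compact set, hence closed. This recovers, for
  a limit of points \<open>g a\<close> with \<open>g \<in> U\<close> and \<open>a \<in> K\<close>, an actual point of \<open>K\<close> related to it.\<close>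

lemma closure_act_set_subset_hat_image:
  assumes "U \<in> N" "closedin X K"
  shows "X closure_of (act_set \<phi> U K) \<subseteq> H U `` K"
proof (rule closure_of_minimal)
  have K: "K \<subseteq> topspace X" using closedin_subset assms by blast
  show "act_set \<phi> U K \<subseteq> H U `` K"
    using act_in_hat assms K unfolding act_set_def by blast
  let ?R = "H U \<inter> K \<times> topspace X"
  have "closedin (prod_topology X X) ?R"
    using closedin_hat assms(2) by (intro closedin_Int) (auto simp: closedin_prod_Times_iff)
  then have "compactin (prod_topology X X) ?R"
    using flow_compact by (intro closedin_compact_space) (auto simp: compact_space_prod_topology)
  then have "compactin X (snd ` ?R)"
    using image_compactin continuous_map_snd by blast
  moreover have "snd ` ?R = H U `` K"
    using hat_subset[of U] by force
  ultimately show "closedin X (H U `` K)"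
    using compactin_imp_closedin flow_Hausdorff by simp
qed

end

section \<open>Maximal high proximality\<close>

context MHP_flow
begin

text \<open>Knowing only that \<open>y\<close> is in the closure of \<open>P\<close>, one cannot use \<open>P\<close> as a neighbourhood of
  \<open>y\<close>. Maximal high proximality repairs this at the cost of the factor \<open>S\<close>.\<close>

lemma hat_closure_step:
  assumes P: "openin X P" "y \<in> X closure_of P" and yz: "(y, z) \<in> H V"
    and V': "V' \<in> N" "nbhd_ll G T V V'" and S: "S \<in> N"
  shows "z \<in> X closure_of (act_set \<phi> V' (act_set \<phi> S P))"
proof -
  let ?Q = "act_set \<phi> S P"
  have "P \<noteq> {}" using P by auto
  then have "y \<in> X interior_of (X closure_of ?Q)"
    using MHP P S by blast
  then have "z \<in> X closure_of (act_set \<phi> V' (X interior_of (X closure_of ?Q)))"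
    using hatD[OF yz _ _ V'] by auto
  also have "\<dots> \<subseteq> X closure_of (act_set \<phi> V' (X closure_of ?Q))"
    by (intro closure_of_mono act_set_mono interior_of_subset order_refl)
  also have "\<dots> \<subseteq> X closure_of (X closure_of (act_set \<phi> V' ?Q))"
    using sym_nbhdsD(3)[OF V'(1)] by (intro closure_of_mono act_set_closure_of_subset)
  finally show ?thesis by simp
qed

text \<open>Each of the three steps from \<open>w\<close> to \<open>z\<close> costs a factor, and \<open>S\<close> is chosen so small that the
  product of all the factors stays inside \<open>W V W \<subseteq> U\<close>.\<close>

lemma hat_sandwich:
  assumes V: "V \<in> N" and U: "U \<in> N" and "nbhd_ll G T V U"
  shows "\<exists>D \<in> N. H D O H V O H D \<subseteq> H U"
proof -
  obtain W where W: "W \<in> N" "W <#> V <#> W \<subseteq> U"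
    using assms(3) unfolding nbhd_ll_def by auto
  obtain R where R: "R \<in> N" "R <#> R \<subseteq> W"
    using sym_nbhd_square_inside W by blast
  obtain S where S: "S \<in> N" "S <#> S \<subseteq> R"
    using sym_nbhd_square_inside R by blast
  obtain D where D: "D \<in> N" "nbhd_ll G T D S"
    using nbhd_ll_below S by blast
  have c: "S \<subseteq> carrier G" "V \<subseteq> carrier G" "R \<subseteq> carrier G" "W \<subseteq> carrier G"
    using S V R W sym_nbhdsD(3) by auto
  let ?V = "S <#> V <#> S"
  have V': "?V \<in> N" "nbhd_ll G T V ?V"
    using sym_nbhd_sandwich S V unfolding nbhd_ll_def by auto
  have cV: "?V \<subseteq> carrier G" using sym_nbhdsD(3) V' by auto
  have SR: "S \<subseteq> R"
    using subset_set_mult_left[OF S(1) c(1)] S(2) by blast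
  \<comment> \<open>Read from the right: two factors for the step to \<open>x\<close>, two for the step to \<open>y\<close> and two
    for the step to \<open>z\<close>.\<close>
  have "S <#> (S <#> (?V <#> (S <#> (S <#> S)))) = (S <#> S <#> S) <#> V <#> ((S <#> S) <#> (S <#> S))"
    using c by (simp add: set_mult_assoc set_mult_closed)
  also have "\<dots> \<subseteq> (R <#> R) <#> V <#> (R <#> R)"
    using S SR by (intro mono_set_mult order_refl)
  also have "\<dots> \<subseteq> W <#> V <#> W"
    using R by (intro mono_set_mult order_refl)
  finally have prod: "S <#> (S <#> (?V <#> (S <#> (S <#> S)))) \<subseteq> U"
    using W by blast
  have "(w, z) \<in> H U" if wx: "(w, x) \<in> H D" and xy: "(x, y) \<in> H V" and yz: "(y, z) \<in> H D" for w x y z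
  proof -
    have t: "w \<in> topspace X" "z \<in> topspace X"
      using wx yz hat_subset by auto
    have "z \<in> X closure_of (act_set \<phi> U' A)"
      if A: "openin X A" "w \<in> A" and U': "U' \<in> N" "nbhd_ll G T U U'" for A U'
    proof -
      have At: "A \<subseteq> topspace X" using openin_subset A by blast
      let ?P1 = "act_set \<phi> S (act_set \<phi> S A)"
      let ?P2 = "act_set \<phi> ?V (act_set \<phi> S ?P1)"
      have op: "openin X ?P1" "openin X ?P2"
        using A c cV by (auto intro!: openin_act_set)
      have "w \<in> X closure_of A"
        using A At closure_of_subset by blast
      then have "x \<in> X closure_of ?P1"
        using hat_closure_step[OF A(1) _ wx S(1) D(2) S(1)] by blast
      then have "y \<in> X closure_of ?P2"
        using hat_closure_step[OF op(1) _ xy V' S(1)] by blast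
      then have "z \<in> X closure_of (act_set \<phi> S (act_set \<phi> S ?P2))"
        using hat_closure_step[OF op(2) _ yz S(1) D(2) S(1)] by blast
      also have "act_set \<phi> S (act_set \<phi> S ?P2)
          = act_set \<phi> (S <#> (S <#> (?V <#> (S <#> (S <#> S))))) A"
        using c(1) cV At
        by (simp add: act_set_act_set act_set_subset_topspace set_mult_closed set_mult_assoc)
      also have "X closure_of \<dots> \<subseteq> X closure_of (act_set \<phi> U' A)"
        using prod nbhd_ll_imp_subset[OF U'(2) sym_nbhdsD(3)[OF U]]
        by (intro closure_of_mono act_set_mono) auto
      finally show ?thesis .
    qed
    then show ?thesis using t unfolding hat_def by blast
  qed
  then show ?thesis using D(1) by blast
qed

lemma entourages_MHP:
  "entourages (topspace X) (MHP_uniformity G T X \<phi>)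
     = {E. E \<subseteq> topspace X \<times> topspace X \<and> (\<exists>U \<in> N. H U \<subseteq> E)}"
proof -
  have "eventually Q (MHP_uniformity G T X \<phi>) \<longleftrightarrow> (\<exists>U \<in> N. eventually Q (principal (H U)))" for Q
    unfolding MHP_uniformity_def
  proof (rule eventually_INF_base)
    show "N \<noteq> {}" using carrier_sym_nbhd by blast
    fix U V assume "U \<in> N" "V \<in> N"
    then show "\<exists>W \<in> N. principal (H W) \<le> inf (principal (H U)) (principal (H V))"
      using sym_nbhds_Int hat_mono by (intro bexI[of _ "U \<inter> V"]) auto
  qed
  then show ?thesis
    unfolding entourages_def by (simp add: eventually_principal subset_eq)
qed

lemma hat_entourage: "U \<in> N \<Longrightarrow> H U \<in> entourages (topspace X) (MHP_uniformity G T X \<phi>)"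
  unfolding entourages_MHP using hat_subset by blast

lemma uniformity_of_MHP: "uniformity_of (topspace X) (MHP_uniformity G T X \<phi>)"
  unfolding uniformity_of_def
proof (intro conjI ballI)
  have "MHP_uniformity G T X \<phi> \<le> principal (H (carrier G))"
    unfolding MHP_uniformity_def using carrier_sym_nbhd by (rule INF_lower)
  also have "\<dots> \<le> principal (topspace X \<times> topspace X)"
    using hat_subset by simp
  finally show "MHP_uniformity G T X \<phi> \<le> principal (topspace X \<times> topspace X)" .
next
  fix E assume "E \<in> entourages (topspace X) (MHP_uniformity G T X \<phi>)"
  then obtain U where E: "E \<subseteq> topspace X \<times> topspace X" and U: "U \<in> N" "H U \<subseteq> E"
    using entourages_MHP by auto
  show "Id_on (topspace X) \<subseteq> E"
    using U Id_on_subset_hat by blast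
  have "H U \<subseteq> E\<inverse>"
    using U(2) hat_sym by (intro subrelI) blast
  then show "E\<inverse> \<in> entourages (topspace X) (MHP_uniformity G T X \<phi>)"
    using U E entourages_MHP by blast
  \<comment> \<open>The first factor \<open>hat D\<close> of the sandwich will be used at a diagonal pair.\<close>
  obtain V where V: "V \<in> N" "nbhd_ll G T V U"
    using nbhd_ll_below U by blast
  then obtain D where D: "D \<in> N" "H D O H V O H D \<subseteq> H U"
    using hat_sandwich U by blast
  let ?D = "H (V \<inter> D)"
  have sub: "?D \<subseteq> H D" "?D \<subseteq> H V"
    by (auto intro: hat_mono[THEN subsetD, rotated])
  have "(x, z) \<in> H U" if "(x, y) \<in> ?D" "(y, z) \<in> ?D" for x y z
  proof -
    have "(x, x) \<in> H D"
      using Id_on_subset_hat[OF D(1)] that(1) hat_subset[of "V \<inter> D"] by auto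
    moreover have "(x, y) \<in> H V" "(y, z) \<in> H D"
      using that sub by auto
    ultimately show ?thesis
      using D(2) by (meson relcompI subsetD)
  qed
  then have "?D O ?D \<subseteq> E" using U(2) by (auto simp: relcomp_unfold)
  then show "\<exists>D \<in> entourages (topspace X) (MHP_uniformity G T X \<phi>). D O D \<subseteq> E"
    using hat_entourage sym_nbhds_Int V D by blast
qed

lemma Hausdorff_uniformity_MHP: "Hausdorff_uniformity (topspace X) (MHP_uniformity G T X \<phi>)"
proof -
  have "\<Inter> (entourages (topspace X) (MHP_uniformity G T X \<phi>)) \<subseteq> Id_on (topspace X)"
    using hat_entourage Inter_hat by blast
  then show ?thesis
    using uniformity_of_MHP unfolding Hausdorff_uniformity_def uniformity_of_def by blast
qed

text \<open>Replacing \<open>hat U\<close> by the union over all \<open>V \<lless> U\<close> leaves room around each of its pairs: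
  it becomes open for the uniformity, so that \<open>A(open_hat U)\<close> is a plain relational image, and
  it carries open sets of \<open>X\<close> to open sets.\<close>

definition open_hat where
  "open_hat U = (\<Union>V \<in> {V \<in> N. nbhd_ll G T V U}. H V)"

lemma entourage_base_open_hat:
  "entourage_base (topspace X) (MHP_uniformity G T X \<phi>) (open_hat ` N)"
proof -
  have "open_hat U \<in> entourages (topspace X) (MHP_uniformity G T X \<phi>)" if "U \<in> N" for U
    using nbhd_ll_below[OF that] hat_subset unfolding entourages_MHP open_hat_def by blast
  moreover have "open_hat U \<subseteq> H U" for U
    unfolding open_hat_def
    by (intro UN_least hat_mono) (simp add: nbhd_ll_imp_subset sym_nbhdsD(3))
  moreover have "\<exists>B \<in> open_hat ` N. B \<subseteq> E"
    if "E \<in> entourages (topspace X) (MHP_uniformity G T X \<phi>)" for E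
  proof -
    obtain U where "U \<in> N" "H U \<subseteq> E"
      using \<open>E \<in> _\<close> unfolding entourages_MHP by blast
    then show ?thesis
      using \<open>open_hat U \<subseteq> H U\<close> by (intro bexI[of _ "open_hat U"]) auto
  qed
  ultimately show ?thesis
    unfolding entourage_base_def by blast
qed

text \<open>An entourage \<open>V \<lless> open_hat U\<close> is contained in \<open>open_hat U\<close>. Conversely
  each of the sets \<open>hat V\<close> that make up \<open>open_hat U\<close> is \<open>\<lless> open_hat U\<close>, by interpolation and the
  sandwich inclusion.\<close>

lemma uopen_image_open_hat:
  assumes "U \<in> N"
  shows "uopen_image (topspace X) (MHP_uniformity G T X \<phi>) A (open_hat U) = open_hat U `` A"
proof
  let ?\<E> = "entourages (topspace X) (MHP_uniformity G T X \<phi>)"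
  have "V \<subseteq> open_hat U" if V: "V \<in> ?\<E>"
    and ll: "entourage_ll (topspace X) (MHP_uniformity G T X \<phi>) V (open_hat U)" for V
  proof -
    obtain W where W: "W \<in> ?\<E>" "W O V O W \<subseteq> open_hat U"
      using ll unfolding entourage_ll_def by blast
    have "Id_on (topspace X) \<subseteq> W" "V \<subseteq> topspace X \<times> topspace X"
      using W(1) V Id_on_subset_hat unfolding entourages_MHP by blast+
    then show ?thesis using W(2) by blast
  qed
  then show "uopen_image (topspace X) (MHP_uniformity G T X \<phi>) A (open_hat U) \<subseteq> open_hat U `` A"
    unfolding uopen_image_def by blast
  have "entourage_ll (topspace X) (MHP_uniformity G T X \<phi>) (H V) (open_hat U)"
    if V: "V \<in> N" "nbhd_ll G T V U" for V
  proof -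
    obtain V' where V': "V' \<in> N" "nbhd_ll G T V V'" "nbhd_ll G T V' U"
      using nbhd_ll_interpolate V by blast
    then obtain D where "D \<in> N" "H D O H V O H D \<subseteq> H V'"
      using hat_sandwich V by blast
    moreover have "H V' \<subseteq> open_hat U"
      using V' unfolding open_hat_def by blast
    ultimately show ?thesis
      using hat_entourage unfolding entourage_ll_def by blast
  qed
  then show "open_hat U `` A \<subseteq> uopen_image (topspace X) (MHP_uniformity G T X \<phi>) A (open_hat U)"
    using hat_entourage unfolding uopen_image_def open_hat_def by blast
qed

text \<open>The witness around a point \<open>y\<close> of the image is the interior of the closure of \<open>V\<^sub>2 B\<close>: maximal
  high proximality places \<open>y\<close> in it, and compactness of \<open>K\<close> keeps it inside the image.\<close>

lemma openin_open_hat_image: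
  assumes A: "openin X A"
  shows "openin X (open_hat U `` A)"
proof (subst openin_subopen, clarify)
  fix x y assume x: "x \<in> A" and "(x, y) \<in> open_hat U"
  then obtain V where V: "V \<in> N" "nbhd_ll G T V U" and xy: "(x, y) \<in> H V"
    unfolding open_hat_def by blast
  obtain V1 where V1: "V1 \<in> N" "nbhd_ll G T V V1" "nbhd_ll G T V1 U"
    using nbhd_ll_interpolate V by blast
  obtain V2 where V2: "V2 \<in> N" "nbhd_ll G T V1 V2" "nbhd_ll G T V2 U"
    using nbhd_ll_interpolate V1 by blast
  obtain S where S: "S \<in> N" "S <#> V1 <#> S \<subseteq> V2"
    using V2(2) unfolding nbhd_ll_def by blast
  have c: "S \<subseteq> carrier G" "V1 \<subseteq> carrier G"
    using S V1 sym_nbhdsD(3) by auto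
  have SV: "S <#> V1 \<subseteq> V2"
    using subset_set_mult_right[OF S(1), of "S <#> V1"] S(2) c set_mult_closed by blast
  have "neighbourhood_base_of (closedin X) X"
    using flow_compact flow_Hausdorff neighbourhood_base_of_closedin
      compact_Hausdorff_imp_regular_space by blast
  then obtain B K where BK: "openin X B" "closedin X K" "x \<in> B" "B \<subseteq> K" "K \<subseteq> A"
    using A x unfolding neighbourhood_base_of by meson
  have Bt: "B \<subseteq> topspace X" using openin_subset BK by blast
  let ?I = "X interior_of (X closure_of (act_set \<phi> V2 B))"
  have ycl: "y \<in> X closure_of (act_set \<phi> V1 B)"
    using hatD[OF xy BK(1,3) V1(1,2)] .
  then have "act_set \<phi> V1 B \<noteq> {}" by auto
  then have "y \<in> X interior_of (X closure_of (act_set \<phi> S (act_set \<phi> V1 B)))"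
    using MHP[OF openin_act_set[OF c(2) BK(1)] _ ycl S(1)] by blast
  also have "act_set \<phi> S (act_set \<phi> V1 B) \<subseteq> act_set \<phi> V2 B"
    using act_set_act_set[OF c Bt] act_set_mono[OF SV, of B B] by auto
  then have "X interior_of (X closure_of (act_set \<phi> S (act_set \<phi> V1 B))) \<subseteq> ?I"
    by (intro interior_of_mono closure_of_mono)
  finally have "y \<in> ?I" .
  moreover have "?I \<subseteq> open_hat U `` A"
  proof -
    have "?I \<subseteq> X closure_of (act_set \<phi> V2 B)"
      by (rule interior_of_subset)
    also have "\<dots> \<subseteq> X closure_of (act_set \<phi> V2 K)"
      using BK by (intro closure_of_mono act_set_mono) auto
    also have "\<dots> \<subseteq> H V2 `` K"
      using closure_act_set_subset_hat_image V2 BK by blast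
    also have "\<dots> \<subseteq> open_hat U `` A"
      using V2 BK unfolding open_hat_def by blast
    finally show ?thesis .
  qed
  ultimately show "\<exists>Q. openin X Q \<and> y \<in> Q \<and> Q \<subseteq> open_hat U `` A"
    by (intro exI[of _ ?I]) simp
qed

end

theorem theorem4p11:
  fixes G :: "('g, 'm) monoid_scheme" and T :: "'g topology"
    and X :: "'x topology" and \<phi> :: "'g \<Rightarrow> 'x \<Rightarrow> 'x"
  assumes "topological_group G T"
    and "MHP_flow G T X \<phi>"
  shows "adequate_topo_uniform_space X (MHP_uniformity G T X \<phi>)"
proof -
  interpret MHP_flow G T X \<phi> by (rule assms(2))
  let ?\<U> = "MHP_uniformity G T X \<phi>"
  show ?thesis
  proof
    show "Hausdorff_space X" by (rule flow_Hausdorff)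
    show "Hausdorff_uniformity (topspace X) ?\<U>" by (rule Hausdorff_uniformity_MHP)
    have "entourage_base (topspace X) ?\<U> (H ` N)"
      using hat_entourage unfolding entourage_base_def entourages_MHP by blast
    then show "\<exists>\<B>. entourage_base (topspace X) ?\<U> \<B> \<and> (\<forall>E \<in> \<B>. closedin (prod_topology X X) E)"
      using closedin_hat by blast
    show "E \<in> entourages (topspace X) ?\<U>"
      if "openin (prod_topology X X) E" "Id_on (topspace X) \<subseteq> E" for E
      using hat_subset_open[OF that] openin_subset[OF that(1)] unfolding entourages_MHP by simp
    show "compact_space X" by (rule flow_compact)
    show "\<exists>\<B>. entourage_base (topspace X) ?\<U> \<B> \<and>
        (\<forall>U \<in> \<B>. \<forall>A. openin X A \<longrightarrow> openin X (uopen_image (topspace X) ?\<U> A U))"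
      using entourage_base_open_hat uopen_image_open_hat openin_open_hat_image
      by (intro exI[of _ "open_hat ` N"]) auto
  qed
qed

end
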